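(* Let $m\ge2$, let $f_1,\dots,f_m\in\mathbb{D}[[x]]$, let $n\in\mathbb{Z}_{\ge-1}^m$, let $i\neq j$ be indices in $\{1,\dots,m\}$ with $n_i,n_j\ge0$, and suppose that the quasideterminants $\rho^i(n)$, $\rho^j(n)$, $\rho^i(n-e_j)$, $\rho^j(n-e_i)$ exist and are nonzero. Then for every $k=1,\dots,m$ the polynomials $\psi_k$ satisfy the linear problem of the non-Abelian Hirota--Miwa system: $$\psi_k(n-e_i,x)-\psi_k(n-e_j,x)=\psi_k(n,x)\,\rho^j(n)\,[\rho^j(n-e_i)]^{-1}.$$
   Context: $\mathbb{D}$ is a (not necessarily commutative) division ring; $f_i(x)=\sum_{j\ge0}f^i_jx^j$, $i=1,\dots,m$, are formal power series with coefficients $f^i_j\in\mathbb{D}$, where $x$ commutes with all elements of $\mathbb{D}$; put $f^i_j=0$ for $j<0$. For $n=(n_1,\dots,n_m)\in\mathbb{Z}_{\ge-1}^m$ write $|n|=n_1+\dots+n_m$; $e_i$ denotes the $i$th standard basis vector of $\mathbb{Z}^m$. Quasideterminant: for a square matrix $X$, let $X^{pq}$ be $X$ with row $p$ and column $q$ deleted. If $X^{pq}$ is invertible, $|X|_{pq}=x_{pq}-r\,(X^{pq})^{-1}c$, where $r$ is row $p$ of $X$ without its $q$th entry and $c$ is column $q$ of $X$ without its $p$th entry (for a $1\times1$ matrix, $|X|_{11}=x_{11}$); the quasideterminant is said to exist when $X^{pq}$ is invertible. When $X$ is invertible and $(X^{-1})_{qp}\ne0$, it equals $((X^{-1})_{qp})^{-1}$.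 Matrix $\mathcal{M}(n)$: it has $|n|+m-1$ rows, indexed $r=0,\dots,|n|+m-2$, and $|n|+m$ columns divided into $m$ consecutive blocks; the $i$th block has $n_i+1$ columns indexed $c=0,\dots,n_i$ (empty if $n_i=-1$), and the entry in row $r$ and column $c$ of block $i$ is $f^i_{r-c}$. For $n_i\ge0$, $\rho^i(n)$ is the quasideterminant, with respect to the element in the last row and the last column of the $i$th block, of the square matrix obtained from $\mathcal{M}(n)$ by adding as last row the row $r=|n|+m-1$ given by the same rule (entries $f^l_{|n|+m-1-c}$, $c=0,\dots,n_l$, in block $l$). For $n_i\ge0$ and $k\in\{1,\dots,m\}$, $Z_k^{(i)}(n,x)$ is the quasideterminant, with respect to the element in the last row and the last column of the $i$th block, of the square matrix obtained from $\mathcal{M}(n)$ by adding as last row $X_k=(0,\dots,0,1,x,\dots,x^{n_k},0,\dots,0)$, which is zero except in block $k$, where it equals $(1,x,\dots,x^{n_k})$. (The submatrix to be inverted is the same as for $\rho^i(n)$ and has entries in $\mathbb{D}$.) $\psi_k(n,x)=Z_k^{(l)}(n,x)[\rho^l(n)]^{-1}$, where $l$ is any index with $n_l\ge0$ for which $\rho^l(n)$ exists and is nonzero (the result does not depend on the choice of such $l$). *)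

theory Defs
  imports
    "HOL-Library.Poly_Mapping"
    "HOL-Computational_Algebra.Formal_Power_Series"
    "Jordan_Normal_Form.Determinant"
begin

text \<open>
  All indices start from 0: the series are \<open>f 0, \<dots>, f (m - 1)\<close>, the multi-index \<open>n\<close> is a vector of
  dimension \<open>m\<close>, the basis vector \<open>e\<^sub>i\<close> is \<open>unit_vec m i\<close>, and rows and columns of matrices are
  numbered from 0.

  The ring \<open>D[x]\<close> with central \<open>x\<close> over a noncommutative \<open>D\<close> is the convolution ring
  \<open>nat \<Rightarrow>\<^sub>0 'a\<close>, in which \<open>Poly_Mapping.single c a\<close> is the monomial \<open>a x\<^sup>c\<close>.
  (The multiplication of \<open>'a poly\<close> is only available for commutative coefficients.)
\<close>

section \<open>Quasideterminants\<close>

definition inverse_matrix :: "'a::ring_1 mat \<Rightarrow> 'a mat" where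
  "inverse_matrix A = (THE B. inverts_mat A B \<and> inverts_mat B A)"

definition quasidet_exists :: "'a::ring_1 mat \<Rightarrow> nat \<Rightarrow> nat \<Rightarrow> bool" where
  "quasidet_exists X p q \<longleftrightarrow> invertible_mat (mat_delete X p q)"

definition quasidet :: "'a::ring_1 mat \<Rightarrow> nat \<Rightarrow> nat \<Rightarrow> 'a" where
  "quasidet X p q =
    (let r = vec (dim_col X - 1) (\<lambda>b. X $$ (p, if b < q then b else Suc b));
         c = vec (dim_row X - 1) (\<lambda>a. X $$ (if a < p then a else Suc a, q))
     in X $$ (p, q) - r \<bullet> (inverse_matrix (mat_delete X p q) *\<^sub>v c))"

section \<open>The block matrices\<close>

definition weight :: "int vec \<Rightarrow> int" where
  "weight n = (\<Sum>l<dim_vec n. n $ l)"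

definition ncols :: "int vec \<Rightarrow> nat" where
  "ncols n = nat (weight n + int (dim_vec n))"

text \<open>The columns from left to right, each given as (block, column index inside the block).\<close>

definition columns :: "int vec \<Rightarrow> (nat \<times> nat) list" where
  "columns n = concat (map (\<lambda>l. map (\<lambda>c. (l, c)) [0..<nat (n $ l + 1)]) [0..<dim_vec n])"

definition last_col :: "int vec \<Rightarrow> nat \<Rightarrow> nat" where
  "last_col n i = nat (\<Sum>l\<le>i. n $ l + 1) - 1"

definition coeff_int :: "'a::zero fps \<Rightarrow> int \<Rightarrow> 'a" where
  "coeff_int F s = (if s < 0 then 0 else fps_nth F (nat s))"

definition coeff_row :: "(nat \<Rightarrow> 'a::zero fps) \<Rightarrow> int vec \<Rightarrow> nat \<Rightarrow> 'a vec" where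
  "coeff_row f n r = vec (ncols n) (\<lambda>q. case columns n ! q of (l, c) \<Rightarrow> coeff_int (f l) (int r - int c))"

definition M_mat :: "(nat \<Rightarrow> 'a::zero fps) \<Rightarrow> int vec \<Rightarrow> 'a mat" where
  "M_mat f n = mat_of_rows (ncols n) (map (coeff_row f n) [0..<ncols n - 1])"

definition X_row :: "int vec \<Rightarrow> nat \<Rightarrow> (nat \<Rightarrow>\<^sub>0 'a::zero_neq_one) vec" where
  "X_row n k = vec (ncols n)
    (\<lambda>q. case columns n ! q of (l, c) \<Rightarrow> if l = k then Poly_Mapping.single c 1 else 0)"

text \<open>Well-formedness of the column enumeration for entries at least \<open>-1\<close>.\<close>

lemma length_columns:
  assumes "\<forall>l<dim_vec n. - 1 \<le> n $ l"
  shows "length (columns n) = ncols n"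
proof -
  have "int (length (columns n)) = (\<Sum>l<dim_vec n. int (nat (n $ l + 1)))"
    by (simp add: columns_def length_concat comp_def interv_sum_list_conv_sum_set_nat
        atLeast0LessThan)
  also have "\<dots> = (\<Sum>l<dim_vec n. n $ l + 1)"
    using assms by (intro sum.cong) auto
  also have "\<dots> = weight n + int (dim_vec n)"
    by (simp add: weight_def sum.distrib)
  finally show ?thesis
    by (simp add: ncols_def)
qed

lemma columns_last_col:
  assumes n: "\<forall>l<dim_vec n. - 1 \<le> n $ l" and i: "i < dim_vec n" "0 \<le> n $ i"
  shows "last_col n i < length (columns n)" and "columns n ! last_col n i = (i, nat (n $ i))"
proof -
  define g where "g = (\<lambda>l. map (\<lambda>c. (l, c)) [0..<nat (n $ l + 1)])"
  have "[0..<dim_vec n] = [0..<i] @ [i] @ [Suc i..<dim_vec n]"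
    using i by (metis append_Cons append_Nil le_add1 less_imp_add_positive upt_add_eq_append
        upt_conv_Cons zero_le)
  then have cols: "columns n = concat (map g [0..<i]) @ g i @ concat (map g [Suc i..<dim_vec n])"
    by (simp add: columns_def g_def)
  have "int (length (concat (map g [0..<i]))) = (\<Sum>l<i. int (nat (n $ l + 1)))"
    by (simp add: g_def length_concat comp_def interv_sum_list_conv_sum_set_nat atLeast0LessThan)
  also have "\<dots> = (\<Sum>l<i. n $ l + 1)"
  proof (intro sum.cong refl)
    fix l assume "l \<in> {..<i}"
    then have "- 1 \<le> n $ l" using n i by auto
    then show "int (nat (n $ l + 1)) = n $ l + 1" by simp
  qed
  finally have "last_col n i = length (concat (map g [0..<i])) + nat (n $ i)"
    using i by (simp add: last_col_def lessThan_Suc_atMost[symmetric] nat_add_distrib)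
  moreover have "nat (n $ i) < length (g i)" "g i ! nat (n $ i) = (i, nat (n $ i))"
    using i by (auto simp: g_def nth_append nat_add_distrib)
  ultimately show "last_col n i < length (columns n)"
      "columns n ! last_col n i = (i, nat (n $ i))"
    unfolding cols by (auto simp: nth_append)
qed

section \<open>The quantities \<open>\<rho>\<close>, \<open>Z\<close> and \<open>\<psi>\<close>\<close>

definition rho_mat :: "(nat \<Rightarrow> 'a::zero fps) \<Rightarrow> int vec \<Rightarrow> 'a mat" where
  "rho_mat f n = M_mat f n @\<^sub>r mat_of_row (coeff_row f n (ncols n - 1))"

definition rho_exists :: "(nat \<Rightarrow> 'a::ring_1 fps) \<Rightarrow> nat \<Rightarrow> int vec \<Rightarrow> bool" where
  "rho_exists f i n \<longleftrightarrow> quasidet_exists (rho_mat f n) (ncols n - 1) (last_col n i)"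

definition rho :: "(nat \<Rightarrow> 'a::ring_1 fps) \<Rightarrow> nat \<Rightarrow> int vec \<Rightarrow> 'a" where
  "rho f i n = quasidet (rho_mat f n) (ncols n - 1) (last_col n i)"

definition Z_poly :: "(nat \<Rightarrow> 'a::ring_1 fps) \<Rightarrow> nat \<Rightarrow> nat \<Rightarrow> int vec \<Rightarrow> (nat \<Rightarrow>\<^sub>0 'a)" where
  "Z_poly f k i n =
    quasidet (map_mat (Poly_Mapping.single 0) (M_mat f n) @\<^sub>r mat_of_row (X_row n k))
      (ncols n - 1) (last_col n i)"

text \<open>
  The common value of \<open>Z_poly f k l n * (rho f l n)\<^sup>-\<^sup>1\<close> over all admissible \<open>l\<close>.  The definite description
  singles out a polynomial only because this value does not depend on \<open>l\<close>.
\<close>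

definition psi :: "(nat \<Rightarrow> 'a::division_ring fps) \<Rightarrow> nat \<Rightarrow> int vec \<Rightarrow> (nat \<Rightarrow>\<^sub>0 'a)" where
  "psi f k n = (THE P. \<exists>l<dim_vec n. 0 \<le> n $ l \<and> rho_exists f l n \<and> rho f l n \<noteq> 0 \<and>
      P = Z_poly f k l n * Poly_Mapping.single 0 (inverse (rho f l n)))"

end

theory Submission
  imports Defs
begin

text \<open>
  A quasideterminant is the value of its row on the vector that is killed by all other rows and is
  1 at the distinguished column.  Hence \<open>\<psi>\<^sub>k(n)\<close> is the \<open>k\<close>-th block, read as a polynomial, of the
  unique vector \<open>a(n)\<close> on which the rows \<open>0, \<dots>, |n| + m - 2\<close> vanish and the next one is 1;
  its entry at the last column of block \<open>l\<close> is \<open>\<rho>\<^sup>l(n)\<^sup>-\<^sup>1\<close>.  After extension by zero,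
  \<open>a(n - e\<^sub>i) - a(n - e\<^sub>j)\<close> lies in the kernel of \<open>M(n)\<close>, which is spanned by \<open>a(n)\<close>, and the factor
  is read off at the last column of block \<open>j\<close>, which \<open>n - e\<^sub>j\<close> lacks.
\<close>

section \<open>Quasideterminants and kernel vectors\<close>

text \<open>\<open>insert_index q\<close> lists the positions other than \<open>q\<close> in
  increasing order, which is the numbering used by \<open>mat_delete\<close>.\<close>

lemma scalar_prod_insert_index:
  fixes r v :: "'a::semiring_0 vec"
  assumes r: "r \<in> carrier_vec N" and v: "v \<in> carrier_vec N" and q: "q < N"
  shows "r \<bullet> v = r $ q * v $ q +
    vec (N - 1) (\<lambda>b. r $ insert_index q b) \<bullet> vec (N - 1) (\<lambda>b. v $ insert_index q b)"
proof -
  have "{0..<N} - {q} = insert_index q ` {0..<N - 1}"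
    using insert_index_image[of q "N - 1"] q by simp
  then have "(\<Sum>b\<in>{0..<N} - {q}. r $ b * v $ b) =
      (\<Sum>b\<in>{0..<N - 1}. r $ insert_index q b * v $ insert_index q b)"
    by (simp add: sum.reindex[OF insert_index_inj_on])
  moreover have "(\<Sum>b\<in>{0..<N}. r $ b * v $ b) = r $ q * v $ q + (\<Sum>b\<in>{0..<N} - {q}. r $ b * v $ b)"
    using q by (intro sum.remove) auto
  ultimately show ?thesis
    using r v by (simp add: scalar_prod_def)
qed

lemma insert_index_cases:
  assumes "b < N" "b \<noteq> q" "q < N"
  obtains c where "c < N - 1" "b = insert_index q c"
proof -
  have "b \<in> insert_index q ` {0..<N - 1}"
    using insert_index_image[of q "N - 1"] assms by simp
  then show ?thesis using that by (elim imageE) simp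
qed

lemma mat_delete_insert_index:
  assumes "X \<in> carrier_mat N N" "a < N - 1" "b < N - 1"
  shows "mat_delete X p q $$ (a, b) = X $$ (insert_index p a, insert_index q b)"
  using assms by (auto simp: mat_delete_def insert_index_def)

text \<open>Turns the equations given by the rows other than \<open>p\<close> into a linear system
  for the minor: if \<open>v $ q = 1\<close>, they say that the minor sends the remaining entries of
  \<open>v\<close> to minus the deleted column.\<close>

lemma mat_delete_mult_vec:
  fixes X :: "'a::semiring_0 mat"
  assumes X: "X \<in> carrier_mat N N" and v: "v \<in> carrier_vec N" and q: "q < N" and a: "a < N - 1"
  shows "row X (insert_index p a) \<bullet> v = X $$ (insert_index p a, q) * v $ q +
    (mat_delete X p q *\<^sub>v vec (N - 1) (\<lambda>b. v $ insert_index q b)) $ a"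
proof -
  have ia: "insert_index p a < N"
    using a by (auto simp: insert_index_def)
  have ib: "insert_index q b < N" if "b < N - 1" for b
    using that by (auto simp: insert_index_def)
  have D: "mat_delete X p q \<in> carrier_mat (N - 1) (N - 1)"
    using mat_delete_carrier[OF X] .
  have "vec (N - 1) (\<lambda>b. row X (insert_index p a) $ insert_index q b) = row (mat_delete X p q) a"
    using X D a ia ib mat_delete_insert_index[OF X] by (intro eq_vecI) auto
  then show ?thesis
    using scalar_prod_insert_index[of "row X (insert_index p a)" N v q] X v q D a ia
    by auto
qed

lemma inverse_matrix_eq:
  assumes A: "A \<in> carrier_mat N N" and inv: "inverts_mat A B" "inverts_mat B A"
  shows "inverse_matrix A = B"
  unfolding inverse_matrix_def
proof (rule the_equality)
  fix C assume C: "inverts_mat A C \<and> inverts_mat C A"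
  \<comment> \<open>\<open>inverts_mat\<close> does not state the shape of the inverse; counting
    columns in the two product identities determines it.\<close>
  have dims: "E \<in> carrier_mat N N" if "inverts_mat A E" "inverts_mat E A" for E
  proof -
    have "dim_col E = N"
      using arg_cong[OF that(1)[unfolded inverts_mat_def], of dim_col] A by simp
    moreover have "dim_row E = N"
      using arg_cong[OF that(2)[unfolded inverts_mat_def], of dim_col] A by simp
    ultimately show ?thesis by auto
  qed
  have "C * (A * B) = C * A * B"
    using A dims[of B] dims[of C] inv C by (metis assoc_mult_mat)
  then show "C = B"
    using A dims[of B] dims[of C] inv C by (simp add: inverts_mat_def)
qed (use inv in simp)

lemma quasidet_existsE:
  fixes X :: "'a::ring_1 mat"
  assumes "quasidet_exists X p q" and X: "X \<in> carrier_mat N N"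
  obtains B where "B \<in> carrier_mat (N - 1) (N - 1)" "inverse_matrix (mat_delete X p q) = B"
    "mat_delete X p q * B = 1\<^sub>m (N - 1)" "B * mat_delete X p q = 1\<^sub>m (N - 1)"
proof -
  have D: "mat_delete X p q \<in> carrier_mat (N - 1) (N - 1)"
    using mat_delete_carrier[OF X] .
  obtain B where B: "inverts_mat (mat_delete X p q) B" "inverts_mat B (mat_delete X p q)"
    using assms(1) unfolding quasidet_exists_def invertible_mat_def by blast
  have "dim_col B = N - 1"
    using arg_cong[OF B(1)[unfolded inverts_mat_def], of dim_col] D
      carrier_matD[OF X] by simp
  moreover have "dim_row B = N - 1"
    using arg_cong[OF B(2)[unfolded inverts_mat_def], of dim_col] D
      carrier_matD[OF X] by simp
  ultimately show ?thesis
    using that[of B] B inverse_matrix_eq[OF D B] D carrier_matD[OF X] by (auto simp: inverts_mat_def)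
qed

text \<open>Since \<open>v\<close> is zero at \<open>q\<close>, its remaining entries are killed by
  the minor, and a left inverse of the minor makes them zero.\<close>

lemma quasidet_kernel_vec_zero:
  fixes X :: "'a::ring_1 mat"
  assumes ex: "quasidet_exists X p q" and X: "X \<in> carrier_mat N N"
    and v: "v \<in> carrier_vec N" and q: "q < N" and vq: "v $ q = 0"
    and ker: "\<And>r. r < N \<Longrightarrow> r \<noteq> p \<Longrightarrow> row X r \<bullet> v = 0"
  shows "v = 0\<^sub>v N"
proof -
  define D where "D = mat_delete X p q"
  define w where "w = vec (N - 1) (\<lambda>b. v $ insert_index q b)"
  have D: "D \<in> carrier_mat (N - 1) (N - 1)"
    using mat_delete_carrier[OF X] by (simp add: D_def)
  obtain B where B: "B \<in> carrier_mat (N - 1) (N - 1)" "B * D = 1\<^sub>m (N - 1)"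
    using quasidet_existsE[OF ex X] unfolding D_def by metis
  have w: "w \<in> carrier_vec (N - 1)"
    by (simp add: w_def)
  have "D *\<^sub>v w = 0\<^sub>v (N - 1)"
  proof (rule eq_vecI)
    fix a assume "a < dim_vec (0\<^sub>v (N - 1) :: 'a vec)"
    then have a: "a < N - 1" by simp
    then have "row X (insert_index p a) \<bullet> v = 0"
      by (intro ker) (auto simp: insert_index_def)
    then show "(D *\<^sub>v w) $ a = 0\<^sub>v (N - 1) $ a"
      using mat_delete_mult_vec[OF X v q a, of p] vq a by (simp add: D_def w_def)
  qed (use D in auto)
  then have "B *\<^sub>v (D *\<^sub>v w) = 0\<^sub>v (N - 1)"
    using B by (intro eq_vecI) auto
  then have w0: "w = 0\<^sub>v (N - 1)"
    using B D w assoc_mult_mat_vec[OF B(1) D w] by simp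
  show ?thesis
  proof (rule eq_vecI)
    fix b assume "b < dim_vec (0\<^sub>v N :: 'a vec)"
    then have b: "b < N" by simp
    show "v $ b = 0\<^sub>v N $ b"
    proof (cases "b = q")
      case False
      then obtain c where "c < N - 1" "b = insert_index q c"
        using insert_index_cases[OF b _ q] by metis
      then show ?thesis
        using w0 b by (metis index_vec index_zero_vec(1) w_def)
    qed (use b vq in simp)
  qed (use v in simp)
qed

text \<open>With 1 at \<open>q\<close>, the other entries have to be
  \<open>-(X^{pq})^{-1} c\<close>. The value of row \<open>p\<close> on this vector is then the
  defining formula \<open>x_pq - r (X^{pq})^{-1} c\<close>.\<close>

lemma quasidet_kernel_vec_exists:
  fixes X :: "'a::ring_1 mat"
  assumes ex: "quasidet_exists X p q" and X: "X \<in> carrier_mat N N" and p: "p < N" and q: "q < N"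
  obtains v where "v \<in> carrier_vec N" "v $ q = 1"
    "\<And>r. r < N \<Longrightarrow> r \<noteq> p \<Longrightarrow> row X r \<bullet> v = 0" "row X p \<bullet> v = quasidet X p q"
proof -
  define D where "D = mat_delete X p q"
  define c where "c = vec (N - 1) (\<lambda>a. X $$ (insert_index p a, q))"
  have D: "D \<in> carrier_mat (N - 1) (N - 1)"
    using mat_delete_carrier[OF X] by (simp add: D_def)
  obtain B where B: "B \<in> carrier_mat (N - 1) (N - 1)" "inverse_matrix D = B" "D * B = 1\<^sub>m (N - 1)"
    using quasidet_existsE[OF ex X] unfolding D_def by metis
  define w where "w = B *\<^sub>v c"
  define v where "v = vec N (\<lambda>b. if b = q then 1 else - (w $ delete_index q b))"
  have c: "c \<in> carrier_vec (N - 1)" and w: "w \<in> carrier_vec (N - 1)" and v: "v \<in> carrier_vec N"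
    using B by (auto simp: c_def w_def v_def)
  have vw: "vec (N - 1) (\<lambda>b. v $ insert_index q b) = - w"
    using w by (intro eq_vecI) (auto simp: v_def insert_index_def delete_index_def)
  have Dw: "D *\<^sub>v w = c"
    using B c D assoc_mult_mat_vec[OF D B(1) c] by (simp add: w_def)
  show ?thesis
  proof
    show "v \<in> carrier_vec N" by fact
    show vq: "v $ q = 1"
      using q by (simp add: v_def)
    show "row X r \<bullet> v = 0" if r: "r < N" "r \<noteq> p" for r
    proof -
      obtain a where a: "a < N - 1" "r = insert_index p a"
        using insert_index_cases[OF r p] by metis
      have "(D *\<^sub>v (- w)) $ a = - (D *\<^sub>v w) $ a"
        using D w a by simp
      then show ?thesis
        using mat_delete_mult_vec[OF X v q a(1), of p] vq vw a Dw
        by (simp add: D_def[symmetric] c_def)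
    qed
    have "quasidet X p q = X $$ (p, q) - vec (N - 1) (\<lambda>b. X $$ (p, insert_index q b)) \<bullet> w"
      using X B(2) by (simp add: quasidet_def Let_def w_def c_def D_def insert_index_def)
    moreover have "vec (N - 1) (\<lambda>b. row X p $ insert_index q b) =
        vec (N - 1) (\<lambda>b. X $$ (p, insert_index q b))"
      using X p by (intro eq_vecI) (auto simp: insert_index_def)
    ultimately show "row X p \<bullet> v = quasidet X p q"
      using scalar_prod_insert_index[of "row X p" N v q] X p q v vq vw w by simp
  qed
qed

text \<open>Two such vectors differ by one that is zero at \<open>q\<close> and killed by the same
  rows, so any of them computes the quasideterminant.\<close>

lemma quasidet_eqI:
  fixes X :: "'a::ring_1 mat"
  assumes ex: "quasidet_exists X p q" and X: "X \<in> carrier_mat N N" and p: "p < N" and q: "q < N"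
    and v: "v \<in> carrier_vec N" and vq: "v $ q = 1"
    and ker: "\<And>r. r < N \<Longrightarrow> r \<noteq> p \<Longrightarrow> row X r \<bullet> v = 0"
  shows "quasidet X p q = row X p \<bullet> v"
proof -
  obtain u where u: "u \<in> carrier_vec N" "u $ q = 1"
    "\<And>r. r < N \<Longrightarrow> r \<noteq> p \<Longrightarrow> row X r \<bullet> u = 0" "row X p \<bullet> u = quasidet X p q"
    using quasidet_kernel_vec_exists[OF ex X p q] by metis
  have "u - v = 0\<^sub>v N"
  proof (rule quasidet_kernel_vec_zero[OF ex X _ q])
    fix r assume r: "r < N" "r \<noteq> p"
    show "row X r \<bullet> (u - v) = 0"
      using scalar_prod_minus_distrib[of "row X r" N u v] X u v ker r by simp
  qed (use u v vq q in auto)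
  have "u = v"
  proof (rule eq_vecI)
    fix b assume "b < dim_vec v"
    then show "u $ b = v $ b"
      using arg_cong[OF \<open>u - v = 0\<^sub>v N\<close>, of "\<lambda>w. w $ b"] u v by simp
  qed (use u v in simp)
  then show ?thesis using u by simp
qed

section \<open>Extension of scalars from \<open>D\<close> to \<open>D[x]\<close>\<close>

lemma single_semiring_hom: "semiring_hom (Poly_Mapping.single 0 :: 'a::ring_1 \<Rightarrow> nat \<Rightarrow>\<^sub>0 'a)"
  by unfold_locales (simp_all add: single_add mult_single)

text \<open>A unital ring homomorphism, applied entrywise, sends a two-sided inverse to a two-sided
  inverse.\<close>

lemma invertible_mat_map_single:
  fixes A :: "'a::ring_1 mat"
  assumes "invertible_mat A"
  shows "invertible_mat (map_mat (Poly_Mapping.single 0) A :: (nat \<Rightarrow>\<^sub>0 'a) mat)"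
proof -
  let ?s = "Poly_Mapping.single 0 :: 'a \<Rightarrow> nat \<Rightarrow>\<^sub>0 'a"
  interpret semiring_hom ?s
    by (rule single_semiring_hom)
  define N where "N = dim_row A"
  obtain B where A: "A \<in> carrier_mat N N" and B: "inverts_mat A B" "inverts_mat B A"
    using assms by (auto simp: invertible_mat_def N_def)
  have "dim_col B = N"
    using arg_cong[OF B(1)[unfolded inverts_mat_def], of dim_col] A by simp
  moreover have "dim_row B = N"
    using arg_cong[OF B(2)[unfolded inverts_mat_def], of dim_col] A by simp
  ultimately have car: "B \<in> carrier_mat N N" by auto
  have "A * B = 1\<^sub>m N" "B * A = 1\<^sub>m N"
    using B A car by (simp_all add: inverts_mat_def)
  then have "map_mat ?s A * map_mat ?s B = 1\<^sub>m N" "map_mat ?s B * map_mat ?s A = 1\<^sub>m N"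
    by (simp_all only: mat_hom_mult[OF A car, symmetric] mat_hom_mult[OF car A, symmetric]
        mat_hom_one)
  then have "inverts_mat (map_mat ?s A) (map_mat ?s B)" "inverts_mat (map_mat ?s B) (map_mat ?s A)"
    using A car by (simp_all add: inverts_mat_def)
  then show ?thesis
    using A unfolding invertible_mat_def by auto
qed

section \<open>Solutions indexed by columns\<close>

lemma mem_columns_iff: "(l, c) \<in> set (columns n) \<longleftrightarrow> l < dim_vec n \<and> int c \<le> n $ l"
  by (auto simp: columns_def image_iff Bex_def zless_nat_eq_int_zless)

text \<open>Makes the passage from positions to pairs (block, column) a bijection, so that scalar
  products become sums over pairs.\<close>

lemma distinct_columns: "distinct (columns n)"
proof -
  have "distinct (concat (map (\<lambda>l. map (\<lambda>c. (l, c)) [0..<nat (n $ l + 1)]) [0..<M]))" for M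
    by (induction M) (auto simp: distinct_map inj_on_def)
  then show ?thesis by (simp add: columns_def)
qed

text \<open>
  Vectors on the columns of \<open>M(n)\<close> are indexed by pairs (block, column) rather than by position, so
  that vectors for different \<open>n\<close> can be compared.
\<close>

definition moment :: "(nat \<Rightarrow> 'a::semiring_0 fps) \<Rightarrow> int vec \<Rightarrow> (nat \<times> nat \<Rightarrow> 'a) \<Rightarrow> nat \<Rightarrow> 'a" where
  "moment f n a r = (\<Sum>x\<in>set (columns n). coeff_int (f (fst x)) (int r - int (snd x)) * a x)"

text \<open>This is the value of the row \<open>X_row n k\<close> on the vector \<open>a\<close> of
  constants.\<close>

definition block_poly :: "int vec \<Rightarrow> nat \<Rightarrow> (nat \<times> nat \<Rightarrow> 'a::semiring_0) \<Rightarrow> (nat \<Rightarrow>\<^sub>0 'a)" where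
  "block_poly n k a =
    (\<Sum>x\<in>set (columns n). if fst x = k then Poly_Mapping.single (snd x) (a x) else 0)"

lemma moment_diff:
  fixes f :: "nat \<Rightarrow> 'a::ring fps"
  shows "moment f n (\<lambda>x. a x - b x) r = moment f n a r - moment f n b r"
  by (simp add: moment_def right_diff_distrib sum_subtractf)

text \<open>Matrix entries multiply from the left, so over a noncommutative ring the solutions can
  be rescaled only from the right.\<close>

lemma moment_mult_right: "moment f n (\<lambda>x. a x * t) r = moment f n a r * t"
  by (simp add: moment_def sum_distrib_right mult.assoc)

lemma block_poly_diff:
  fixes a :: "nat \<times> nat \<Rightarrow> 'a::ring"
  shows "block_poly n k (\<lambda>x. a x - b x) = block_poly n k a - block_poly n k b"
  by (auto simp: block_poly_def single_diff sum_subtractf[symmetric] intro!: sum.cong)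

lemma block_poly_mult_right:
  "block_poly n k (\<lambda>x. a x * t) = block_poly n k a * Poly_Mapping.single 0 t"
  by (auto simp: block_poly_def sum_distrib_right mult_single intro!: sum.cong)

text \<open>The entry in row \<open>r\<close> and column \<open>(l, c)\<close> does not depend on
  the multi-index, so extension by zero preserves every moment.\<close>

lemma moment_extend:
  assumes "set (columns n') \<subseteq> set (columns n)"
  shows "moment f n (\<lambda>x. if x \<in> set (columns n') then a x else 0) r = moment f n' a r"
  unfolding moment_def using assms by (intro sum.mono_neutral_cong_right) auto

lemma block_poly_extend:
  assumes "set (columns n') \<subseteq> set (columns n)"
  shows "block_poly n k (\<lambda>x. if x \<in> set (columns n') then a x else 0) = block_poly n' k a"
  unfolding block_poly_def using assms by (intro sum.mono_neutral_cong_right) auto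

lemma block_poly_zero: "(\<And>x. x \<in> set (columns n) \<Longrightarrow> a x = 0) \<Longrightarrow> block_poly n k a = 0"
  by (auto simp: block_poly_def intro!: sum.neutral)

lemma moment_zero: "(\<And>x. x \<in> set (columns n) \<Longrightarrow> a x = 0) \<Longrightarrow> moment f n a r = 0"
  by (auto simp: moment_def intro!: sum.neutral)

section \<open>Rows of the block matrices as functionals on pairs\<close>

context
  fixes n :: "int vec" and l :: nat
  assumes valid: "\<forall>l<dim_vec n. - 1 \<le> n $ l" and l: "l < dim_vec n" "0 \<le> n $ l"
begin

text \<open>In particular \<open>ncols n\<close> is positive, so \<open>ncols n - 1\<close> is a
  genuine row index and not a truncated difference.\<close>

lemma last_col_less_ncols: "last_col n l < ncols n"
  using columns_last_col(1)[OF valid l] length_columns[OF valid] by simp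

lemma sum_columns_nth:
  "(\<Sum>q\<in>{0..<ncols n}. h (columns n ! q)) = (\<Sum>x\<in>set (columns n). h x)"
  using sum.reindex_bij_betw[OF bij_betw_nth[OF distinct_columns refl refl], of h n]
  by (simp add: length_columns[OF valid] atLeast0LessThan)

lemma coeff_row_scalar_prod:
  "coeff_row f n r \<bullet> vec (ncols n) (\<lambda>q. a (columns n ! q)) = moment f n a r"
  by (simp add: moment_def scalar_prod_def coeff_row_def case_prod_beta sum_columns_nth[symmetric])

lemma X_row_scalar_prod:
  fixes a :: "nat \<times> nat \<Rightarrow> 'a::ring_1"
  shows "X_row n k \<bullet> vec (ncols n) (\<lambda>q. Poly_Mapping.single 0 (a (columns n ! q))) = block_poly n k a"
  by (auto simp: block_poly_def scalar_prod_def X_row_def case_prod_beta sum_columns_nth[symmetric]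
      mult_single intro!: sum.cong)

lemma rho_mat_carrier: "rho_mat f n \<in> carrier_mat (ncols n) (ncols n)"
  using last_col_less_ncols by (auto simp: rho_mat_def M_mat_def append_rows_def)

lemma row_rho_mat:
  assumes "r < ncols n"
  shows "row (rho_mat f n) r = coeff_row f n r"
proof (rule eq_vecI)
  fix q assume "q < dim_vec (coeff_row f n r)"
  then have q: "q < ncols n" by (simp add: coeff_row_def)
  have "r = ncols n - 1" if "\<not> r < ncols n - 1" using that assms by simp
  then show "row (rho_mat f n) r $ q = coeff_row f n r $ q"
    using q assms carrier_matD[OF rho_mat_carrier[of f]]
    by (auto simp: rho_mat_def M_mat_def append_rows_def coeff_row_def mat_of_rows_def mat_of_row_def)
qed (use carrier_matD[OF rho_mat_carrier[of f]] in \<open>simp add: coeff_row_def\<close>)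

text \<open>The enumeration of columns has no repetitions, so its inverse \<open>g\<close> recovers
  the position from the pair.\<close>

lemma coeffs_of_vec:
  assumes "v \<in> carrier_vec (ncols n)"
  obtains a where "v = vec (ncols n) (\<lambda>q. a (columns n ! q))"
proof
  define g where "g = inv_into {..<ncols n} ((!) (columns n))"
  have "inj_on ((!) (columns n)) {..<ncols n}"
    using inj_on_nth[OF distinct_columns, of "{..<ncols n}" n] length_columns[OF valid] by simp
  then show "v = vec (ncols n) (\<lambda>q. v $ g (columns n ! q))"
    using assms by (intro eq_vecI) (auto simp: g_def)
qed

abbreviation Z_mat :: "(nat \<Rightarrow> 'a::ring_1 fps) \<Rightarrow> nat \<Rightarrow> (nat \<Rightarrow>\<^sub>0 'a) mat" where
  "Z_mat f k \<equiv> map_mat (Poly_Mapping.single 0) (M_mat f n) @\<^sub>r mat_of_row (X_row n k)"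

lemma Z_mat_carrier: "Z_mat f k \<in> carrier_mat (ncols n) (ncols n)"
  using last_col_less_ncols by (auto simp: M_mat_def append_rows_def X_row_def)

lemma row_Z_mat_last: "row (Z_mat f k) (ncols n - 1) = X_row n k"
  using last_col_less_ncols by (intro eq_vecI) (auto simp: M_mat_def append_rows_def X_row_def)

lemma row_Z_mat:
  assumes "r < ncols n - 1"
  shows "row (Z_mat f k) r = map_vec (Poly_Mapping.single 0) (coeff_row f n r)"
  using assms by (intro eq_vecI)
    (auto simp: M_mat_def append_rows_def X_row_def coeff_row_def mat_of_rows_def)

text \<open>The two matrices differ, up to the embedding of constants, only in the deleted last row;
  hence existence of \<rho> entails existence of \<open>Z\<close>.\<close>

lemma mat_delete_Z_mat:
  "mat_delete (Z_mat f k) (ncols n - 1) q =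
    map_mat (Poly_Mapping.single 0) (mat_delete (rho_mat f n) (ncols n - 1) q)"
  by (intro eq_matI) (auto simp: rho_mat_def M_mat_def append_rows_def X_row_def mat_delete_def)

section \<open>The kernel of \<open>M(n)\<close>\<close>

lemma kernel_zero:
  fixes f :: "nat \<Rightarrow> 'a::ring_1 fps"
  assumes ex: "rho_exists f l n" and ker: "\<And>r. r < ncols n - 1 \<Longrightarrow> moment f n a r = 0"
    and a: "a (l, nat (n $ l)) = 0" and x: "x \<in> set (columns n)"
  shows "a x = 0"
proof -
  define v where "v = vec (ncols n) (\<lambda>q. a (columns n ! q))"
  have v0: "v = 0\<^sub>v (ncols n)"
  proof (rule quasidet_kernel_vec_zero)
    show "quasidet_exists (rho_mat f n) (ncols n - 1) (last_col n l)"
      using ex by (simp add: rho_exists_def)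
    show "v $ last_col n l = 0"
      using a last_col_less_ncols columns_last_col(2)[OF valid l] by (simp add: v_def)
    show "row (rho_mat f n) r \<bullet> v = 0" if "r < ncols n" "r \<noteq> ncols n - 1" for r
      using that ker[of r] by (simp add: row_rho_mat coeff_row_scalar_prod v_def)
  qed (use rho_mat_carrier last_col_less_ncols in \<open>auto simp: v_def\<close>)
  obtain q where "q < ncols n" "columns n ! q = x"
    using x length_columns[OF valid] by (metis in_set_conv_nth)
  then show ?thesis
    using arg_cong[OF v0, of "\<lambda>w. w $ q"] by (simp add: v_def)
qed

text \<open>The matrices of \<rho> and of all \<open>Z_k\<close> share every row but the last, so a
  single vector \<open>b\<close> over \<open>D\<close> evaluates all these quasideterminants at
  once.\<close>

lemma kernel_exists:
  fixes f :: "nat \<Rightarrow> 'a::ring_1 fps"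
  assumes ex: "rho_exists f l n"
  shows "\<exists>b. b (l, nat (n $ l)) = 1 \<and> (\<forall>r<ncols n - 1. moment f n b r = 0) \<and>
    moment f n b (ncols n - 1) = rho f l n \<and> (\<forall>k. Z_poly f k l n = block_poly n k b)"
proof -
  let ?p = "ncols n - 1" and ?q = "last_col n l"
  have p: "?p < ncols n" using last_col_less_ncols by simp
  have qex: "quasidet_exists (rho_mat f n) ?p ?q"
    using ex by (simp add: rho_exists_def)
  obtain v where v: "v \<in> carrier_vec (ncols n)" "v $ ?q = 1"
    "\<And>r. r < ncols n \<Longrightarrow> r \<noteq> ?p \<Longrightarrow> row (rho_mat f n) r \<bullet> v = 0"
    "row (rho_mat f n) ?p \<bullet> v = rho f l n"
    using quasidet_kernel_vec_exists[OF qex rho_mat_carrier p last_col_less_ncols]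
    unfolding rho_def by metis
  obtain b where b: "v = vec (ncols n) (\<lambda>q. b (columns n ! q))"
    using coeffs_of_vec[OF v(1)] .
  have mom: "row (rho_mat f n) r \<bullet> v = moment f n b r" if "r < ncols n" for r
    using that by (simp add: row_rho_mat b coeff_row_scalar_prod)
  show ?thesis
  proof (intro exI conjI allI impI)
    show "b (l, nat (n $ l)) = 1"
      using v(2) last_col_less_ncols columns_last_col(2)[OF valid l] by (simp add: b)
    show "moment f n b r = 0" if "r < ?p" for r
      using that v(3)[of r] mom[of r] by simp
    show "moment f n b ?p = rho f l n"
      using v(4) mom[OF p] by simp
    fix k
    interpret semiring_hom "Poly_Mapping.single 0 :: 'a \<Rightarrow> nat \<Rightarrow>\<^sub>0 'a"
      by (rule single_semiring_hom)
    let ?s = "Poly_Mapping.single 0 :: 'a \<Rightarrow> nat \<Rightarrow>\<^sub>0 'a"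
    \<comment> \<open>The vector found for \<rho> is embedded into \<open>D[x]\<close> and reused,
      instead of solving a new system for each \<open>k\<close>.\<close>
    have "quasidet (Z_mat f k) ?p ?q = row (Z_mat f k) ?p \<bullet> map_vec ?s v"
    proof (rule quasidet_eqI[OF _ Z_mat_carrier p last_col_less_ncols])
      show "quasidet_exists (Z_mat f k) ?p ?q"
        using qex unfolding quasidet_exists_def mat_delete_Z_mat by (rule invertible_mat_map_single)
      show "map_vec ?s v $ ?q = 1"
        using v last_col_less_ncols by simp
      fix r assume r: "r < ncols n" "r \<noteq> ?p"
      then have "row (Z_mat f k) r = map_vec ?s (coeff_row f n r)"
        by (intro row_Z_mat) simp
      moreover have "map_vec ?s (coeff_row f n r) \<bullet> map_vec ?s v = ?s (coeff_row f n r \<bullet> v)"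
        using v(1) by (simp add: scalar_prod_def coeff_row_def hom_sum hom_mult)
      ultimately show "row (Z_mat f k) r \<bullet> map_vec ?s v = 0"
        using v(3)[OF r] r by (simp add: row_rho_mat)
    qed (use v in simp)
    moreover have "map_vec ?s v = vec (ncols n) (\<lambda>q. ?s (b (columns n ! q)))"
      unfolding b by (intro eq_vecI) auto
    ultimately show "Z_poly f k l n = block_poly n k b"
      by (simp only: Z_poly_def row_Z_mat_last X_row_scalar_prod)
  qed
qed

text \<open>The vector \<open>a - b t\<close>, with \<open>t\<close> the entry of \<open>a\<close>
  at the last column of block \<open>l\<close>, lies in the kernel and is zero at that column. So
  \<open>a = b t\<close> on all columns, and both values follow from those of
  \<open>b\<close>.\<close>

lemma kernel_solution:
  fixes f :: "nat \<Rightarrow> 'a::ring_1 fps"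
  assumes ex: "rho_exists f l n" and ker: "\<And>r. r < ncols n - 1 \<Longrightarrow> moment f n a r = 0"
  shows "moment f n a (ncols n - 1) = rho f l n * a (l, nat (n $ l))"
    and "block_poly n k a = Z_poly f k l n * Poly_Mapping.single 0 (a (l, nat (n $ l)))"
proof -
  obtain b where b: "b (l, nat (n $ l)) = 1" "\<forall>r<ncols n - 1. moment f n b r = 0"
    "moment f n b (ncols n - 1) = rho f l n" "\<forall>k. Z_poly f k l n = block_poly n k b"
    using kernel_exists[OF ex] by blast
  define t where "t = a (l, nat (n $ l))"
  have z: "a x - b x * t = 0" if "x \<in> set (columns n)" for x
  proof (rule kernel_zero[OF ex, where a = "\<lambda>x. a x - b x * t"])
    show "moment f n (\<lambda>x. a x - b x * t) r = 0" if "r < ncols n - 1" for r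
      using that b(2) ker[OF that] by (simp add: moment_diff moment_mult_right)
    show "a (l, nat (n $ l)) - b (l, nat (n $ l)) * t = 0"
      by (simp add: b(1) t_def)
  qed (rule that)
  show "moment f n a (ncols n - 1) = rho f l n * t"
    using moment_zero[of n "\<lambda>x. a x - b x * t" f "ncols n - 1", OF z] b(3) by (simp add: moment_diff moment_mult_right)
  show "block_poly n k a = Z_poly f k l n * Poly_Mapping.single 0 t"
    using block_poly_zero[of n "\<lambda>x. a x - b x * t" k, OF z] b(4) by (simp add: block_poly_diff block_poly_mult_right)
qed

end

section \<open>Normalized kernel vectors and \<psi>\<close>

text \<open>The condition on \<open>a(n)\<close>. It mentions no block \<open>l\<close>, which is
  the source of the independence of \<psi> from \<open>l\<close>.\<close>

definition normalized :: "(nat \<Rightarrow> 'a::semiring_1 fps) \<Rightarrow> int vec \<Rightarrow> (nat \<times> nat \<Rightarrow> 'a) \<Rightarrow> bool" where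
  "normalized f n a \<longleftrightarrow>
    (\<forall>r<ncols n - 1. moment f n a r = 0) \<and> moment f n a (ncols n - 1) = 1"

context
  fixes f :: "nat \<Rightarrow> 'a::division_ring fps" and n :: "int vec" and l :: nat
  assumes valid: "\<forall>l<dim_vec n. - 1 \<le> n $ l" and l: "l < dim_vec n" "0 \<le> n $ l"
    and rho: "rho_exists f l n" "rho f l n \<noteq> 0"
begin

text \<open>The kernel vector with entry 1 at the last column of block \<open>l\<close> has last
  moment \<rho>; right division by \<rho> normalizes it.\<close>

lemma normalized_exists: "\<exists>a. normalized f n a"
proof -
  obtain b where b: "\<forall>r<ncols n - 1. moment f n b r = 0"
    "moment f n b (ncols n - 1) = rho f l n"
    using kernel_exists[OF valid l rho(1)] by blast
  then have "normalized f n (\<lambda>x. b x * inverse (rho f l n))"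
    using rho(2) by (simp add: normalized_def moment_mult_right)
  then show ?thesis by blast
qed

lemma normalized_lead:
  assumes "normalized f n a"
  shows "a (l, nat (n $ l)) = inverse (rho f l n)"
proof -
  have "rho f l n * a (l, nat (n $ l)) = 1"
    using kernel_solution(1)[OF valid l rho(1), of a] assms by (simp add: normalized_def)
  then show ?thesis
    by (rule inverse_unique[symmetric])
qed

lemma normalized_block_poly:
  assumes "normalized f n a"
  shows "block_poly n k a = Z_poly f k l n * Poly_Mapping.single 0 (inverse (rho f l n))"
proof -
  have "block_poly n k a = Z_poly f k l n * Poly_Mapping.single 0 (a (l, nat (n $ l)))"
    using assms by (intro kernel_solution(2)[OF valid l rho(1)]) (simp add: normalized_def)
  then show ?thesis
    by (simp only: normalized_lead[OF assms])
qed

end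

text \<open>The same \<open>a\<close> can be compared with every admissible block, so all candidates
  in the definite description equal its block polynomial.\<close>

lemma psi_eq_block_poly:
  assumes valid: "\<forall>l<dim_vec n. - 1 \<le> n $ l" and l: "l < dim_vec n" "0 \<le> n $ l"
    and rho: "rho_exists f l n" "rho f l n \<noteq> 0" and a: "normalized f n a"
  shows "psi f k n = block_poly n k a"
  unfolding psi_def
proof (rule the_equality)
  show "\<exists>l<dim_vec n. 0 \<le> n $ l \<and> rho_exists f l n \<and> rho f l n \<noteq> 0 \<and>
      block_poly n k a = Z_poly f k l n * Poly_Mapping.single 0 (inverse (rho f l n))"
    using l rho normalized_block_poly[OF valid l rho a] by blast
next
  fix P assume "\<exists>l<dim_vec n. 0 \<le> n $ l \<and> rho_exists f l n \<and> rho f l n \<noteq> 0 \<and>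
      P = Z_poly f k l n * Poly_Mapping.single 0 (inverse (rho f l n))"
  then obtain l' where "l' < dim_vec n" "0 \<le> n $ l'" "rho_exists f l' n" "rho f l' n \<noteq> 0"
      "P = Z_poly f k l' n * Poly_Mapping.single 0 (inverse (rho f l' n))"
    by blast
  then show "P = block_poly n k a"
    using normalized_block_poly[OF valid _ _ _ _ a] by simp
qed

section \<open>The linear problem\<close>

lemma columns_minus_unit:
  assumes "n \<in> carrier_vec m" "i < m"
  shows "set (columns (n - unit_vec m i)) \<subseteq> set (columns n)"
proof
  fix x assume x: "x \<in> set (columns (n - unit_vec m i))"
  obtain l c where lc: "x = (l, c)" by (cases x)
  show "x \<in> set (columns n)"
    using x assms unfolding lc mem_columns_iff by (auto split: if_splits)
qed

text \<open>Consequently the row on which \<open>a(n - e_i)\<close> takes the value 1 is the last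
  row of \<open>M(n)\<close>.\<close>

lemma ncols_minus_unit:
  assumes "n \<in> carrier_vec m" "i < m"
  shows "ncols (n - unit_vec m i) = ncols n - 1"
proof -
  have "weight (n - unit_vec m i) = weight n - 1"
    using assms by (simp add: weight_def sum_subtractf)
  then show ?thesis
    using assms by (simp add: ncols_def)
qed

theorem proposition3p6:
  fixes f :: "nat \<Rightarrow> 'a::division_ring fps" and n :: "int vec" and m i j k :: nat
  assumes "m \<ge> 2"
    and "n \<in> carrier_vec m" and "\<forall>l<m. n $ l \<ge> - 1"
    and "i < m" and "j < m" and "i \<noteq> j"
    and "n $ i \<ge> 0" and "n $ j \<ge> 0"
    and "rho_exists f i n" and "rho f i n \<noteq> 0"
    and "rho_exists f j n" and "rho f j n \<noteq> 0"
    and "rho_exists f i (n - unit_vec m j)" and "rho f i (n - unit_vec m j) \<noteq> 0"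
    and "rho_exists f j (n - unit_vec m i)" and "rho f j (n - unit_vec m i) \<noteq> 0"
    and "k < m"
  shows "psi f k (n - unit_vec m i) - psi f k (n - unit_vec m j) =
    psi f k n * Poly_Mapping.single 0 (rho f j n * inverse (rho f j (n - unit_vec m i)))"
proof -
  let ?ni = "n - unit_vec m i" and ?nj = "n - unit_vec m j"
  note n = assms(2)
  have valid: "\<forall>l<dim_vec n. - 1 \<le> n $ l" "\<forall>l<dim_vec ?ni. - 1 \<le> ?ni $ l"
    "\<forall>l<dim_vec ?nj. - 1 \<le> ?nj $ l"
    using assms(2-8) by auto
  \<comment> \<open>Subtracting \<open>e_i\<close> may empty block \<open>i\<close>, so block
    \<open>j\<close> serves for \<open>n - e_i\<close>, and block \<open>i\<close> for
    \<open>n - e_j\<close>.\<close>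
  have j: "j < dim_vec n" "0 \<le> n $ j" and ji: "j < dim_vec ?ni" "0 \<le> ?ni $ j"
    and ij: "i < dim_vec ?nj" "0 \<le> ?nj $ i"
    using assms(2-8) by auto
  obtain a where a: "normalized f n a"
    using normalized_exists[OF valid(1) j assms(11,12)] by blast
  obtain ai where ai: "normalized f ?ni ai"
    using normalized_exists[OF valid(2) ji assms(15,16)] by blast
  obtain aj where aj: "normalized f ?nj aj"
    using normalized_exists[OF valid(3) ij assms(13,14)] by blast
  have sub: "set (columns ?ni) \<subseteq> set (columns n)" "set (columns ?nj) \<subseteq> set (columns n)"
    using columns_minus_unit[OF n] assms(4,5) by blast+
  define d where "d = (\<lambda>x. (if x \<in> set (columns ?ni) then ai x else 0) -
    (if x \<in> set (columns ?nj) then aj x else 0))"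
  \<comment> \<open>Both vectors have moment 0 in all rows of \<open>M(n)\<close> except the last,
    where both have moment 1 and the difference cancels.\<close>
  have "moment f n d r = 0" if "r < ncols n - 1" for r
  proof -
    have "r < ncols n - 1 - 1 \<or> r = ncols n - 1 - 1" using that by auto
    then show ?thesis
      using ai aj ncols_minus_unit[OF n] assms(4,5)
      by (auto simp: d_def moment_diff moment_extend[OF sub(1)] moment_extend[OF sub(2)] normalized_def)
  qed
  note d = kernel_solution(2)[OF valid(1) j assms(11) this, of k]
  \<comment> \<open>As \<open>i\<close> and \<open>j\<close> differ, this column is still the last
    one of block \<open>j\<close> for \<open>n - e_i\<close>; only \<open>ai\<close> contributes to
    the entry of \<open>d\<close> there.\<close>
  have "(j, nat (n $ j)) \<in> set (columns ?ni)" "(j, nat (n $ j)) \<notin> set (columns ?nj)"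
    using n assms(4-8) by (auto simp: mem_columns_iff)
  then have lead: "d (j, nat (n $ j)) = inverse (rho f j ?ni)"
    using normalized_lead[OF valid(2) ji assms(15,16) ai] n assms(4-6) by (simp add: d_def)
  have "psi f k ?ni - psi f k ?nj = block_poly n k d"
    using psi_eq_block_poly[OF valid(2) ji assms(15,16) ai]
      psi_eq_block_poly[OF valid(3) ij assms(13,14) aj]
    by (simp add: d_def block_poly_diff block_poly_extend[OF sub(1)] block_poly_extend[OF sub(2)])
  also have "\<dots> = Z_poly f k j n * Poly_Mapping.single 0 (inverse (rho f j ?ni))"
    using d lead by simp
  \<comment> \<open>The nonzero \<rho> of block \<open>j\<close> at \<open>n\<close> and its inverse
    are inserted after \<open>Z\<close>. The first simplification merges the constants into one
    monomial, the second regroups them so that the inverse pair cancels.\<close>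
  also have "\<dots> = psi f k n * Poly_Mapping.single 0 (rho f j n * inverse (rho f j ?ni))"
    using psi_eq_block_poly[OF valid(1) j assms(11,12) a, of k]
      normalized_block_poly[OF valid(1) j assms(11,12) a, of k] assms(12)
    by (simp add: mult_single mult.assoc) (simp add: mult.assoc[symmetric])
  finally show ?thesis .
qed

end
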